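(* Consider one time step $(t_n,t_{n+1})$, $\Delta t_n=t_{n+1}-t_n>0$, of the fully discrete scheme for incompressible elastodynamics described in the context, and let $\{\boldsymbol U_n,P_n,\boldsymbol V_n\}$ and $\{\boldsymbol U_{n+1},P_{n+1},\boldsymbol V_{n+1}\}$ be elements of the trial spaces satisfying the three discrete equations (i)-(iii) of the context for all test functions. Assume $\Gamma^G_{\boldsymbol X}=\emptyset$. Then the discrete linear momentum satisfies $$\frac{1}{\Delta t_n}(\boldsymbol L_{n+1}-\boldsymbol L_n)=\int_{\Omega_{\boldsymbol X}}\rho_0\boldsymbol B_m\,d\Omega_{\boldsymbol X}+\int_{\Gamma^H_{\boldsymbol X}}\boldsymbol H_m\,d\Gamma_{\boldsymbol X}.$$ If, further, the algorithmic stress $\boldsymbol S_{\mathrm{alg}}$ is symmetric, then the discrete angular momentum satisfies $$\frac{1}{\Delta t_n}(\boldsymbol J_{n+1}-\boldsymbol J_n)=\int_{\Omega_{\boldsymbol X}}\rho_0\,\boldsymbol\varphi_m\times\boldsymbol B_m\,d\Omega_{\boldsymbol X}+\int_{\Gamma^H_{\boldsymbol X}}\boldsymbol\varphi_m\times\boldsymbol H_m\,d\Gamma_{\boldsymbol X}.$$ Here, for $k\in\{n,n+1\}$, $$\boldsymbol L_k:=\int_{\Omega_{\boldsymbol X}}\rho_0\boldsymbol V_k\,d\Omega_{\boldsymbol X},\qquad \boldsymbol J_k:=\int_{\Omega_{\boldsymbol X}}\rho_0\,\boldsymbol\varphi_k\times\boldsymbol V_k\,d\Omega_{\boldsymbol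 X},$$ with $\boldsymbol\varphi_k(\boldsymbol X)=\boldsymbol X+\boldsymbol U_k(\boldsymbol X)$ and $\boldsymbol\varphi_m(\boldsymbol X)=\boldsymbol X+\boldsymbol U_m(\boldsymbol X)$.
   Context: Domain and data. $\Omega_{\boldsymbol X}\subset\mathbb R^3$ is a bounded open set with Lipschitz boundary $\Gamma_{\boldsymbol X}=\Gamma^G_{\boldsymbol X}\cup\Gamma^H_{\boldsymbol X}$ (disjoint Dirichlet and Neumann parts). $\rho_0>0$ is the density, $\gamma\ge0$ a constant (grad-div stabilization parameter), $\boldsymbol B(\boldsymbol X,t)$ the body force per unit mass, $\boldsymbol H(\boldsymbol X,t)$ the traction prescribed on $\Gamma^H_{\boldsymbol X}$, $\boldsymbol G(\boldsymbol X,t)$ the displacement prescribed on $\Gamma^G_{\boldsymbol X}$. All fields are assumed regular enough that every integral below is finite. Conventions: $(\nabla_{\boldsymbol X}\boldsymbol W)_{iI}=\partial W_i/\partial X_I$, $\boldsymbol A:\boldsymbol B=\sum_{i,j} A_{ij}B_{ij}$. Discrete spaces. Let $\hat\Omega=(0,1)^3$. $\mathcal R^{q_1,q_2,q_3}_{\boldsymbol\alpha_1,\boldsymbol\alpha_2,\boldsymbol\alpha_3}$ denotes the space of trivariate NURBS on $\hat\Omega$ built from open knot vectors, i.e. the span of $w_AB_A/\sum_Bw_BB_B$ where $B_A$ are the tensor-product B-splines of degree $q_d$ and inter-element regularity $\boldsymbol\alpha_d$ in direction $d$, and $w_A>0$ are given weights. With integers $\mathsf a\ge1$, $0\le\mathsf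 b<\mathsf a$, let $\hat{\mathcal S}_h=\big(\mathcal R^{\mathsf p+\mathsf a,\mathsf p+\mathsf a,\mathsf p+\mathsf a}_{\boldsymbol r_1+\mathsf b,\boldsymbol r_2+\mathsf b,\boldsymbol r_3+\mathsf b}\big)^3$ and $\hat{\mathcal P}_h=\mathcal R^{\mathsf p,\mathsf p,\mathsf p}_{\boldsymbol r_1,\boldsymbol r_2,\boldsymbol r_3}$, where functions in $\hat{\mathcal S}_h$ are continuous. Let $\boldsymbol\psi:\hat\Omega\to\Omega_{\boldsymbol X}$ be a smooth invertible geometrical map; displacement and velocity are interpolated isoparametrically, i.e. $\boldsymbol\psi\in\hat{\mathcal S}_h$. Set $\mathcal S_h=\{\boldsymbol W:\boldsymbol W\circ\boldsymbol\psi\in\hat{\mathcal S}_h\}$, $\mathcal P_h=\{Q:Q\circ\boldsymbol\psi\in\hat{\mathcal P}_h\}$. Trial spaces at time $t$: displacements $\boldsymbol U\in\mathcal S_h$ with $\boldsymbol U=\boldsymbol G(\cdot,t)$ on $\Gamma^G_{\boldsymbol X}$; pressures $P\in\mathcal P_h$; velocities $\boldsymbol V\in\mathcal S_h$ with $\boldsymbol V=\frac{d\boldsymbol G}{dt}(\cdot,t)$ on $\Gamma^G_{\boldsymbol X}$. Test spaces: $\mathcal V_{\boldsymbol V}=\{\boldsymbol W\in\mathcal S_h:\boldsymbol W=\boldsymbol 0\text{ on }\Gamma^G_{\boldsymbol X}\}$ and $\mathcal V_P=\mathcal P_h$. (When $\Gamma^G_{\boldsymbol X}=\emptyset$ there are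 no boundary constraints.) Mid-point quantities. $\boldsymbol U_m=\frac12(\boldsymbol U_n+\boldsymbol U_{n+1})$, $P_m=\frac12(P_n+P_{n+1})$, $\boldsymbol V_m=\frac12(\boldsymbol V_n+\boldsymbol V_{n+1})$, $\boldsymbol F_m=\nabla_{\boldsymbol X}\boldsymbol U_m+\boldsymbol I$, $J_m=\det\boldsymbol F_m$, assumed positive; $\boldsymbol B_m=\boldsymbol B(\cdot,t_m)$, $\boldsymbol H_m=\boldsymbol H(\cdot,t_m)$ with $t_m=\frac12(t_n+t_{n+1})$. The algorithmic (isochoric second Piola-Kirchhoff) stress $\boldsymbol S_{\mathrm{alg}}$ is a $3\times3$ tensor field on $\Omega_{\boldsymbol X}$, which may depend on the states at $t_n$ and $t_{n+1}$; no specific formula for it is prescribed here. Scheme. The discrete equations are, for all $\boldsymbol W\in\mathcal V_{\boldsymbol V}$, $Q\in\mathcal V_P$: (i) $\displaystyle \boldsymbol 0=\frac{\boldsymbol U_{n+1}-\boldsymbol U_n}{\Delta t_n}-\boldsymbol V_m$ in $\Omega_{\boldsymbol X}$; (ii) $\displaystyle 0=\int_{\Omega_{\boldsymbol X}}Q\,J_m\nabla_{\boldsymbol X}\boldsymbol V_m:\boldsymbol F_m^{-\mathrm T}\,d\Omega_{\boldsymbol X}$; (iii) $\displaystyle 0=\int_{\Omega_{\boldsymbol X}}\Big[\boldsymbol W\cdot\rho_0\frac{\boldsymbol V_{n+1}-\boldsymbol V_n}{\Delta t_n}+(\boldsymbol F_m^{\mathrm T}\nabla_{\boldsymbol X}\boldsymbol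 W):\boldsymbol S_{\mathrm{alg}}-J_mP_m\nabla_{\boldsymbol X}\boldsymbol W:\boldsymbol F_m^{-\mathrm T}-\boldsymbol W\cdot\rho_0\boldsymbol B_m\Big]d\Omega_{\boldsymbol X}-\int_{\Gamma^H_{\boldsymbol X}}\boldsymbol W\cdot\boldsymbol H_m\,d\Gamma_{\boldsymbol X}+\int_{\Omega_{\boldsymbol X}}\gamma J_m\big(\nabla_{\boldsymbol X}\boldsymbol W:\boldsymbol F_m^{-\mathrm T}\big)\big(\nabla_{\boldsymbol X}\boldsymbol V_m:\boldsymbol F_m^{-\mathrm T}\big)d\Omega_{\boldsymbol X}.$ *)

theory Defs
  imports "HOL-Analysis.Analysis"
begin

text \<open>Surface measure: the two-dimensional Hausdorff measure in space, normalised by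
  \<open>pi * (diameter / 2)^2\<close> so that it agrees with area on smooth surfaces, on its Caratheodory
  measurable sets (which form a complete measure space containing the Borel sets).\<close>

definition hausdorff2_delta :: "real \<Rightarrow> (real^3) set \<Rightarrow> ennreal" where
  "hausdorff2_delta \<delta> A =
     (INF E \<in> {E :: nat \<Rightarrow> (real^3) set. A \<subseteq> (\<Union>i. E i) \<and> (\<forall>i. bounded (E i) \<and> diameter (E i) \<le> \<delta>)}.
        (\<Sum>i. ennreal (pi * (diameter (E i) / 2)^2)))"

definition hausdorff2_outer :: "(real^3) set \<Rightarrow> ennreal" where
  "hausdorff2_outer A = (SUP \<delta> \<in> {0<..}. hausdorff2_delta \<delta> A)"

definition surface_measure :: "(real^3) measure" where
  "surface_measure =
     measure_of UNIV (lambda_system UNIV (Pow UNIV) hausdorff2_outer) hausdorff2_outer"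

lemma hausdorff2_delta_mono: "A \<subseteq> B \<Longrightarrow> hausdorff2_delta \<delta> A \<le> hausdorff2_delta \<delta> B"
  unfolding hausdorff2_delta_def by (rule INF_superset_mono) auto

lemma hausdorff2_delta_Union:
  fixes A :: "nat \<Rightarrow> (real^3) set"
  shows "hausdorff2_delta \<delta> (\<Union>i. A i) \<le> (\<Sum>i. hausdorff2_delta \<delta> (A i))"
proof (rule ennreal_le_epsilon)
  fix e :: real
  assume fin: "(\<Sum>i. hausdorff2_delta \<delta> (A i)) < top" and e: "0 < e"
  let ?C = "\<lambda>A. {E :: nat \<Rightarrow> (real^3) set. A \<subseteq> (\<Union>i. E i) \<and> (\<forall>i. bounded (E i) \<and> diameter (E i) \<le> \<delta>)}"
  let ?s = "\<lambda>E. (\<Sum>i. ennreal (pi * (diameter (E i :: (real^3) set) / 2)^2))"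
  have "\<exists>E. E \<in> ?C (A n) \<and> ?s E \<le> hausdorff2_delta \<delta> (A n) + ennreal (e * (1/2)^Suc n)" for n
  proof -
    have "hausdorff2_delta \<delta> (A n) < top"
      using fin ennreal_suminf_lessD by blast
    then have "hausdorff2_delta \<delta> (A n) < hausdorff2_delta \<delta> (A n) + ennreal (e * (1/2)^Suc n)"
      using e by (cases "hausdorff2_delta \<delta> (A n)") (auto simp: ennreal_less_iff simp flip: ennreal_plus)
    then show ?thesis
      unfolding hausdorff2_delta_def[of _ "A n"] INF_less_iff by (meson less_imp_le)
  qed
  then have "\<exists>E. \<forall>n. E n \<in> ?C (A n) \<and> ?s (E n) \<le> hausdorff2_delta \<delta> (A n) + ennreal (e * (1/2)^Suc n)"
    by (intro choice allI)
  then obtain E where E: "\<forall>n. E n \<in> ?C (A n) \<and> ?s (E n) \<le> hausdorff2_delta \<delta> (A n) + ennreal (e * (1/2)^Suc n)"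
    ..
  have EC: "E n \<in> ?C (A n)" for n
    using E[rule_format, of n] by (rule conjunct1)
  have Es: "?s (E n) \<le> hausdorff2_delta \<delta> (A n) + ennreal (e * (1/2)^Suc n)" for n
    using E[rule_format, of n] by (rule conjunct2)
  define F where "F = (\<lambda>k. case prod_decode k of (n, i) \<Rightarrow> E n i)"
  have "F \<in> ?C (\<Union>i. A i)"
  proof (clarsimp, intro conjI subsetI)
    fix x assume "x \<in> (\<Union>i. A i)"
    then obtain n where "x \<in> A n" by blast
    then obtain i where "x \<in> E n i" using EC[of n] by blast
    then have "x \<in> F (prod_encode (n, i))" by (simp add: F_def)
    then show "x \<in> (\<Union>i. F i)" by blast
  next
    show "\<forall>i. bounded (F i) \<and> diameter (F i) \<le> \<delta>"
      using EC by (auto simp: F_def split: prod.split)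
  qed
  then have "hausdorff2_delta \<delta> (\<Union>i. A i) \<le> ?s F"
    unfolding hausdorff2_delta_def by (rule INF_lower)
  also have "?s F = (\<Sum>n. ?s (E n))"
    by (subst suminf_ennreal_2dimen[symmetric, where g = "\<lambda>n. ?s (E n)"
          and f = "\<lambda>(n, i). ennreal (pi * (diameter (E n i) / 2)^2)"])
       (auto simp: F_def comp_def split: prod.split intro!: suminf_cong)
  also have "\<dots> \<le> (\<Sum>n. hausdorff2_delta \<delta> (A n) + ennreal (e * (1/2)^Suc n))"
    by (intro suminf_le Es) auto
  also have "\<dots> = (\<Sum>n. hausdorff2_delta \<delta> (A n)) + (\<Sum>n. ennreal (e * (1/2)^Suc n))"
    by (rule suminf_add[symmetric]) auto
  also have "(\<Sum>n. ennreal (e * (1/2)^Suc n)) = ennreal e"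
    using e sums_mult[OF power_half_series, of e]
    by (intro suminf_ennreal_eq) auto
  finally show "hausdorff2_delta \<delta> (\<Union>i. A i) \<le> (\<Sum>i. hausdorff2_delta \<delta> (A i)) + ennreal e" .
qed

lemma measure_space_surface_measure:
  "measure_space UNIV (lambda_system UNIV (Pow UNIV) hausdorff2_outer) hausdorff2_outer"
proof -
  have empty: "hausdorff2_delta \<delta> {} = 0" if "0 < \<delta>" for \<delta>
  proof -
    have "hausdorff2_delta \<delta> {} \<le> (\<Sum>i::nat. ennreal (pi * (diameter ({} :: (real^3) set) / 2)^2))"
      unfolding hausdorff2_delta_def using that by (intro INF_lower) auto
    then show ?thesis by simp
  qed
  have "outer_measure_space (Pow UNIV) hausdorff2_outer"
    unfolding outer_measure_space_def
  proof (intro conjI)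
    show "positive (Pow UNIV) hausdorff2_outer"
      by (simp add: positive_def hausdorff2_outer_def empty)
    show "increasing (Pow UNIV) hausdorff2_outer"
      by (auto simp: increasing_def hausdorff2_outer_def intro!: SUP_mono hausdorff2_delta_mono)
    have "hausdorff2_outer (\<Union>i. A i) \<le> (\<Sum>i. hausdorff2_outer (A i))" for A :: "nat \<Rightarrow> _"
      unfolding hausdorff2_outer_def[of "\<Union>i. A i"]
    proof (rule SUP_least)
      fix \<delta> :: real assume d: "\<delta> \<in> {0<..}"
      have "hausdorff2_delta \<delta> (\<Union>i. A i) \<le> (\<Sum>i. hausdorff2_delta \<delta> (A i))"
        by (rule hausdorff2_delta_Union)
      also have "\<dots> \<le> (\<Sum>i. hausdorff2_outer (A i))"
        unfolding hausdorff2_outer_def using d by (intro suminf_le SUP_upper) auto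
      finally show "hausdorff2_delta \<delta> (\<Union>i. A i) \<le> (\<Sum>i. hausdorff2_outer (A i))" .
    qed
    then show "countably_subadditive (Pow UNIV) hausdorff2_outer"
      by (auto simp: countably_subadditive_def)
  qed
  then show ?thesis
    by (rule sigma_algebra.caratheodory_lemma[OF sigma_algebra_Pow])
qed

text \<open>Near each boundary point the set lies strictly above the graph of a Lipschitz function over
  the hyperplane orthogonal to some unit vector \<open>\<nu>\<close>; since \<open>V\<close> is open, the boundary in \<open>V\<close>
  is then the graph itself.\<close>

definition lipschitz_boundary :: "'a::euclidean_space set \<Rightarrow> bool" where
  "lipschitz_boundary \<Omega> \<longleftrightarrow>
     (\<forall>x \<in> frontier \<Omega>. \<exists>V \<nu> L g. open V \<and> x \<in> V \<and> norm \<nu> = 1 \<and> L-lipschitz_on {y. y \<bullet> \<nu> = 0} g \<and>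
        \<Omega> \<inter> V = {y \<in> V. g (y - (y \<bullet> \<nu>) *\<^sub>R \<nu>) < y \<bullet> \<nu>})"

text \<open>Boundary value of a field on \<open>\<Omega>\<close>: its limit from inside.\<close>

definition trace_on :: "'a::metric_space set \<Rightarrow> ('a \<Rightarrow> 'b::t2_space) \<Rightarrow> 'a \<Rightarrow> 'b" where
  "trace_on \<Omega> W x = Lim (at x within \<Omega>) W"

text \<open>Univariate splines. The mesh is the strictly increasing list of distinct knots; \<open>\<alpha> i\<close> is the
  regularity at the \<open>i\<close>-th one (interior \<open>i\<close> only), giving multiplicity \<open>q - \<alpha> i\<close>. The end knots have
  multiplicity \<open>q + 1\<close>.\<close>

definition unit_mesh :: "real list \<Rightarrow> bool" where
  "unit_mesh \<zeta> \<longleftrightarrow> 2 \<le> length \<zeta> \<and> sorted_wrt (<) \<zeta> \<and> hd \<zeta> = 0 \<and> last \<zeta> = 1"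

definition open_knots :: "nat \<Rightarrow> real list \<Rightarrow> (nat \<Rightarrow> int) \<Rightarrow> real list" where
  "open_knots q \<zeta> \<alpha> =
     replicate (q + 1) (hd \<zeta>)
     @ concat (map (\<lambda>i. replicate (nat (int q - \<alpha> i)) (\<zeta> ! i)) [1..<length \<zeta> - 1])
     @ replicate (q + 1) (last \<zeta>)"

text \<open>Cox-de Boor recursion; the convention \<open>0/0 = 0\<close> is that of HOL.\<close>

fun bspline :: "real list \<Rightarrow> nat \<Rightarrow> nat \<Rightarrow> real \<Rightarrow> real" where
  "bspline k 0 i x = (if k ! i \<le> x \<and> x < k ! (i + 1) then 1 else 0)"
| "bspline k (Suc q) i x =
     (x - k ! i) / (k ! (i + q + 1) - k ! i) * bspline k q i x +
     (k ! (i + q + 2) - x) / (k ! (i + q + 2) - k ! (i + 1)) * bspline k q (i + 1) x"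

text \<open>Trivariate NURBS: \<open>q\<close>, \<open>\<zeta>\<close>, \<open>\<alpha>\<close> give degree, mesh and regularity in each of the three
  directions; multi-indices are functions \<open>3 \<Rightarrow> nat\<close>.\<close>

definition tp_index :: "(3 \<Rightarrow> nat) \<Rightarrow> (3 \<Rightarrow> real list) \<Rightarrow> (3 \<Rightarrow> nat \<Rightarrow> int) \<Rightarrow> (3 \<Rightarrow> nat) set" where
  "tp_index q \<zeta> \<alpha> = {A. \<forall>d. A d < length (open_knots (q d) (\<zeta> d) (\<alpha> d)) - (q d + 1)}"

definition tp_bspline ::
  "(3 \<Rightarrow> nat) \<Rightarrow> (3 \<Rightarrow> real list) \<Rightarrow> (3 \<Rightarrow> nat \<Rightarrow> int) \<Rightarrow> (3 \<Rightarrow> nat) \<Rightarrow> real^3 \<Rightarrow> real" where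
  "tp_bspline q \<zeta> \<alpha> A \<xi> = (\<Prod>d\<in>UNIV. bspline (open_knots (q d) (\<zeta> d) (\<alpha> d)) (q d) (A d) (\<xi> $ d))"

abbreviation unit_cube :: "(real^3) set" where
  "unit_cube \<equiv> box 0 1"

definition nurbs_basis ::
  "(3 \<Rightarrow> nat) \<Rightarrow> (3 \<Rightarrow> real list) \<Rightarrow> (3 \<Rightarrow> nat \<Rightarrow> int) \<Rightarrow> ((3 \<Rightarrow> nat) \<Rightarrow> real) \<Rightarrow> (3 \<Rightarrow> nat) \<Rightarrow> real^3 \<Rightarrow> real" where
  "nurbs_basis q \<zeta> \<alpha> w A \<xi> =
     w A * tp_bspline q \<zeta> \<alpha> A \<xi> / (\<Sum>B\<in>tp_index q \<zeta> \<alpha>. w B * tp_bspline q \<zeta> \<alpha> B \<xi>)"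

text \<open>Functions are total in HOL; only their values on the open cube are constrained.\<close>

definition nurbs_space ::
  "(3 \<Rightarrow> nat) \<Rightarrow> (3 \<Rightarrow> real list) \<Rightarrow> (3 \<Rightarrow> nat \<Rightarrow> int) \<Rightarrow> ((3 \<Rightarrow> nat) \<Rightarrow> real) \<Rightarrow> (real^3 \<Rightarrow> real) set" where
  "nurbs_space q \<zeta> \<alpha> w =
     {f. \<exists>c. \<forall>\<xi>\<in>unit_cube. f \<xi> = (\<Sum>A\<in>tp_index q \<zeta> \<alpha>. c A * nurbs_basis q \<zeta> \<alpha> w A \<xi>)}"

definition nurbs_space3 ::
  "(3 \<Rightarrow> nat) \<Rightarrow> (3 \<Rightarrow> real list) \<Rightarrow> (3 \<Rightarrow> nat \<Rightarrow> int) \<Rightarrow> ((3 \<Rightarrow> nat) \<Rightarrow> real) \<Rightarrow> (real^3 \<Rightarrow> real^3) set" where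
  "nurbs_space3 q \<zeta> \<alpha> w = {f. \<forall>i. (\<lambda>\<xi>. f \<xi> $ i) \<in> nurbs_space q \<zeta> \<alpha> w}"

text \<open>Fields on the physical domain whose pull-back by \<open>\<psi>\<close> lies in a given space on the cube.\<close>

definition push_space :: "('a \<Rightarrow> 'b) \<Rightarrow> ('a \<Rightarrow> 'c) set \<Rightarrow> ('b \<Rightarrow> 'c) set" where
  "push_space \<psi> S = {W. W \<circ> \<psi> \<in> S}"

text \<open>A geometrical map given by splines is in general smooth only inside the mesh elements, so
  regularity and invertibility of the derivative are required there; \<open>differentiable\<close> suffices as
  NURBS are rational inside the elements.\<close>

definition geometrical_map :: "(3 \<Rightarrow> real list) \<Rightarrow> (real^3) set \<Rightarrow> (real^3 \<Rightarrow> real^3) \<Rightarrow> bool" where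
  "geometrical_map \<zeta> \<Omega> \<psi> \<longleftrightarrow>
     (\<exists>\<psi>'. homeomorphism unit_cube \<Omega> \<psi> \<psi>') \<and>
     (\<forall>\<xi>\<in>unit_cube. (\<forall>d. \<xi> $ d \<notin> set (\<zeta> d)) \<longrightarrow>
        \<psi> differentiable (at \<xi>) \<and> det (jacobian \<psi> (at \<xi>)) \<noteq> 0)"

text \<open>Fields of a space \<open>S\<close> with prescribed boundary values \<open>g\<close> on \<open>\<Gamma>\<close>.\<close>

definition with_bc ::
  "(real^3 \<Rightarrow> real^3) set \<Rightarrow> (real^3) set \<Rightarrow> (real^3) set \<Rightarrow> (real^3 \<Rightarrow> real^3) \<Rightarrow> (real^3 \<Rightarrow> real^3) set" where
  "with_bc S \<Omega> \<Gamma> g = {W \<in> S. \<forall>x\<in>\<Gamma>. (W \<longlongrightarrow> g x) (at x within \<Omega>)}"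

text \<open>The \<open>(i,I)\<close> entry of \<open>jacobian W (at X)\<close> is the derivative of component \<open>i\<close> in direction \<open>I\<close>.
  Discrete fields are differentiable almost everywhere only; elsewhere the value is arbitrary. The
  contraction \<open>A : B\<close> is the inner product of \<open>real^3^3\<close>, the sum of products of entries.\<close>

abbreviation grad :: "(real^3 \<Rightarrow> real^3) \<Rightarrow> real^3 \<Rightarrow> real^3^3" where
  "grad W X \<equiv> jacobian W (at X)"

definition inv_transp :: "real^3^3 \<Rightarrow> real^3^3" where
  "inv_transp F = transpose (matrix_inv F)"

definition linear_momentum :: "(real^3) set \<Rightarrow> (real^3 \<Rightarrow> real) \<Rightarrow> (real^3 \<Rightarrow> real^3) \<Rightarrow> real^3" where
  "linear_momentum \<Omega> \<rho> V = (LINT X|lebesgue_on \<Omega>. \<rho> X *\<^sub>R V X)"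

definition angular_momentum ::
  "(real^3) set \<Rightarrow> (real^3 \<Rightarrow> real) \<Rightarrow> (real^3 \<Rightarrow> real^3) \<Rightarrow> (real^3 \<Rightarrow> real^3) \<Rightarrow> real^3" where
  "angular_momentum \<Omega> \<rho> \<phi> V = (LINT X|lebesgue_on \<Omega>. \<rho> X *\<^sub>R cross3 (\<phi> X) (V X))"

abbreviation surface_on :: "(real^3) set \<Rightarrow> (real^3) measure" where
  "surface_on \<Gamma> \<equiv> restrict_space surface_measure \<Gamma>"

end

theory Submission
  imports Defs
begin

text \<open>With \<open>\<Gamma>G\<close> empty, infinitesimal rigid motions of the mid-point configuration are admissible test
  functions in (iii): constants \<open>c\<close> because NURBS contain the constants, and \<open>c \<times> \<phi>_m\<close> because the
  interpolation is isoparametric. Their gradients are \<open>0\<close> and \<open>K F_m\<close> with \<open>K\<close> the skew matrix of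
  \<open>c \<times> _\<close>, so \<open>F_m\<^sup>T K F_m\<close> is skew and orthogonal to a symmetric stress, and
  \<open>K F_m : F_m\<^sup>-\<^sup>T = tr K = 0\<close> removes the pressure and grad-div terms. What remains is the momentum
  balance tested with \<open>c\<close>; the mid-point rule (i) turns \<open>\<phi>_m \<times> (V_n1 - V_n)\<close> into the increment
  of \<open>\<phi> \<times> V\<close>. The gradient formula holds almost everywhere only, which requires the image of the
  element interfaces under \<open>\<psi>\<close> to be a null set.\<close>

section \<open>B-splines and NURBS\<close>

text \<open>A Cox-de Boor step joins the supports of two neighbouring splines. The half-open form
  goes back to degree zero; it fixes the signs of the recursion weights in the lemmas below.\<close>

lemma bspline_support:
  assumes "sorted k" "i + q + 1 < length k" "bspline k q i x \<noteq> 0"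
  shows "k ! i \<le> x \<and> x < k ! (i + q + 1)"
  using assms(2,3)
proof (induction q arbitrary: i)
  case 0
  then show ?case by (auto split: if_splits)
next
  case (Suc q)
  from Suc.prems(2) consider "bspline k q i x \<noteq> 0" | "bspline k q (i + 1) x \<noteq> 0"
    by (cases "bspline k q i x = 0") auto
  then show ?case
  proof cases
    case 1
    then have "k ! i \<le> x \<and> x < k ! (i + q + 1)" using Suc by simp
    moreover have "k ! (i + q + 1) \<le> k ! (i + Suc q + 1)"
      using assms(1) Suc.prems by (intro sorted_nth_mono) auto
    ultimately show ?thesis by linarith
  next
    case 2
    then have "k ! (i + 1) \<le> x \<and> x < k ! (i + 1 + q + 1)" by (intro Suc.IH) (use Suc.prems in auto)
    moreover have "k ! i \<le> k ! (i + 1)"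
      using assms(1) Suc.prems by (intro sorted_nth_mono) auto
    ultimately show ?thesis by simp
  qed
qed

text \<open>A recursion weight can be negative only off the support of the spline it multiplies, and
  there the product vanishes; hence the case split on the value of that spline.\<close>

lemma bspline_nonneg:
  assumes "sorted k" "i + q + 1 < length k"
  shows "0 \<le> bspline k q i x"
  using assms(2)
proof (induction q arbitrary: i)
  case 0
  then show ?case by simp
next
  case (Suc q)
  have "0 \<le> (x - k ! i) / (k ! (i + q + 1) - k ! i) * bspline k q i x"
  proof (cases "bspline k q i x = 0")
    case False
    then have "k ! i \<le> x \<and> x < k ! (i + q + 1)"
      using bspline_support[OF assms(1) _ False] Suc.prems by simp
    then show ?thesis using Suc.IH[of i] Suc.prems by simp
  qed simp
  moreover have "0 \<le> (k ! (i + q + 2) - x) / (k ! (i + q + 2) - k ! (i + 1)) * bspline k q (i + 1) x"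
  proof (cases "bspline k q (i + 1) x = 0")
    case False
    then have "k ! (i + 1) \<le> x \<and> x < k ! (i + q + 2)"
      using bspline_support[OF assms(1), of "i + 1" q x] Suc.prems by simp
    then show ?thesis using Suc.IH[of "i + 1"] Suc.prems by simp
  qed simp
  ultimately show ?case by simp
qed

text \<open>On a knot interval the first B-spline whose support contains it is strictly positive even at
  the left end, because the second Cox-de Boor weight is.\<close>

lemma bspline_pos:
  assumes "sorted k" "i + q + 1 < length k" "k ! (i + q) \<le> x" "x < k ! (i + q + 1)"
  shows "0 < bspline k q i x"
  using assms(2-)
proof (induction q arbitrary: i)
  case 0
  then show ?case by simp
next
  case (Suc q)
  have "0 < bspline k q (i + 1) x"
    using Suc.prems by (intro Suc.IH) auto
  moreover have "k ! (i + 1) \<le> k ! (i + Suc q)"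
    using assms(1) Suc.prems by (intro sorted_nth_mono) auto
  ultimately have "0 < (k ! (i + q + 2) - x) / (k ! (i + q + 2) - k ! (i + 1)) * bspline k q (i + 1) x"
    using Suc.prems by (intro mult_pos_pos divide_pos_pos) auto
  moreover have "0 \<le> (x - k ! i) / (k ! (i + q + 1) - k ! i) * bspline k q i x"
  proof (cases "bspline k q i x = 0")
    case False
    then have "k ! i \<le> x \<and> x < k ! (i + q + 1)"
      using bspline_support[OF assms(1) _ False] Suc.prems by simp
    moreover have "0 \<le> bspline k q i x"
      using Suc.prems by (intro bspline_nonneg assms) simp
    ultimately show ?thesis by simp
  qed simp
  ultimately show ?case by simp
qed

text \<open>With no knot strictly between \<open>u\<close> and \<open>v\<close>, the spline is one
  polynomial on the interval. The left end belongs to it because degree-zero splines are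
  right-continuous; at \<open>u\<close> the derivative is one-sided.\<close>

lemma bspline_differentiable_on:
  assumes "i + q + 1 < length k" "\<And>t. t \<in> set k \<Longrightarrow> t \<le> u \<or> v \<le> t"
  shows "bspline k q i differentiable_on {u..<v}"
  using assms(1)
proof (induction q arbitrary: i)
  case 0
  have "k ! i \<in> set k" "k ! (i + 1) \<in> set k" using 0 by auto
  then have "k ! i \<le> u \<or> v \<le> k ! i" "k ! (i + 1) \<le> u \<or> v \<le> k ! (i + 1)"
    using assms(2) by blast+
  then have const: "bspline k 0 i x = bspline k 0 i u" if "x \<in> {u..<v}" for x
    using that by auto
  have "bspline k 0 i differentiable at x within {u..<v}" if "x \<in> {u..<v}" for x
    by (rule differentiable_transform_within[of "\<lambda>_. bspline k 0 i u", OF _ zero_less_one that])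
      (simp_all only: const differentiable_const)
  then show ?case unfolding differentiable_on_def by blast
next
  case (Suc q)
  have 1: "bspline k q i differentiable_on {u..<v}" "bspline k q (i + 1) differentiable_on {u..<v}"
    using Suc by simp_all
  \<comment> \<open>Division by a knot difference becomes multiplication by a constant, so
    coinciding knots form no separate case.\<close>
  have "(\<lambda>x. (x - k ! i) * inverse (k ! (i + q + 1) - k ! i) * bspline k q i x +
     (k ! (i + q + 2) - x) * inverse (k ! (i + q + 2) - k ! (i + 1)) * bspline k q (i + 1) x)
     differentiable_on {u..<v}"
    by (intro differentiable_on_add differentiable_on_mult differentiable_on_diff 1
        differentiable_on_const differentiable_on_ident)
  then show ?case by (simp add: divide_inverse[abs_def] fun_eq_iff[symmetric])
qed

section \<open>Open knot vectors of a mesh\<close>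

lemma sorted_concat_replicate:
  "sorted (map f xs) \<Longrightarrow> sorted (concat (map (\<lambda>i. replicate (m i) (f i)) xs))"
  by (induction xs) (auto simp: sorted_append)

lemma unit_mesh_nth:
  assumes "unit_mesh \<zeta>"
  shows "\<zeta> ! 0 = 0" "\<zeta> ! (length \<zeta> - 1) = 1"
    "i < j \<Longrightarrow> j < length \<zeta> \<Longrightarrow> \<zeta> ! i < \<zeta> ! j"
  using assms
  by (auto simp: unit_mesh_def hd_conv_nth last_conv_nth sorted_wrt_iff_nth_less
      simp flip: length_greater_0_conv)

lemma unit_mesh_range:
  assumes "unit_mesh \<zeta>" "t \<in> set \<zeta>"
  shows "0 \<le> t" "t \<le> 1"
proof -
  obtain i where i: "i < length \<zeta>" "t = \<zeta> ! i" using assms(2) by (auto simp: in_set_conv_nth)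
  show "0 \<le> t" using unit_mesh_nth(1)[OF assms(1)] unit_mesh_nth(3)[OF assms(1), of 0 i] i
    by (cases "i = 0") auto
  show "t \<le> 1" using unit_mesh_nth(2)[OF assms(1)]
      unit_mesh_nth(3)[OF assms(1), of i "length \<zeta> - 1"] i
    by (cases "i = length \<zeta> - 1") (auto simp: less_imp_le)
qed

lemma set_open_knots:
  assumes "unit_mesh \<zeta>" shows "set (open_knots q \<zeta> \<alpha>) \<subseteq> set \<zeta>"
proof -
  have "\<zeta> \<noteq> []" using assms by (auto simp: unit_mesh_def)
  then have "hd \<zeta> \<in> set \<zeta>" "last \<zeta> \<in> set \<zeta>" by simp_all
  then show ?thesis by (auto simp: open_knots_def)
qed

lemma sorted_open_knots:
  assumes "unit_mesh \<zeta>" shows "sorted (open_knots q \<zeta> \<alpha>)"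
proof -
  have "sorted (map ((!) \<zeta>) [1..<length \<zeta> - 1])"
    unfolding sorted_iff_nth_mono
    using unit_mesh_nth(3)[OF assms] by (force simp: le_less)
  then have "sorted (concat (map (\<lambda>i. replicate (nat (int q - \<alpha> i)) (\<zeta> ! i)) [1..<length \<zeta> - 1]))"
    by (rule sorted_concat_replicate)
  moreover have "hd \<zeta> = 0" "last \<zeta> = 1" using assms by (auto simp: unit_mesh_def)
  ultimately show ?thesis
    using unit_mesh_range[OF assms] by (auto simp: open_knots_def sorted_append)
qed

text \<open>Index \<open>q\<close> is the last of the \<open>q + 1\<close> copies of 0, and the
  other index is the first of the \<open>q + 1\<close> copies of 1. They delimit the search for a
  knot span.\<close>

lemma open_knots_ends:
  assumes "unit_mesh \<zeta>"
  shows "open_knots q \<zeta> \<alpha> ! q = 0"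
    "open_knots q \<zeta> \<alpha> ! (length (open_knots q \<zeta> \<alpha>) - (q + 1)) = 1"
    "2 * q + 2 \<le> length (open_knots q \<zeta> \<alpha>)"
  using assms by (simp_all add: open_knots_def unit_mesh_def nth_append del: replicate_Suc)

text \<open>The least index \<open>j\<close> whose shifted knot \<open>k ! (j + q)\<close> exceeds
  \<open>x\<close> ends the knot span containing \<open>x\<close>; \<open>bspline_pos\<close> then
  applies to the predecessor of \<open>j\<close>.\<close>

lemma exists_bspline_pos:
  fixes q :: nat and \<zeta> :: "real list" and \<alpha> :: "nat \<Rightarrow> int" and x :: real
  assumes "unit_mesh \<zeta>" "0 < x" "x < 1"
  defines "k \<equiv> open_knots q \<zeta> \<alpha>"
  shows "\<exists>i. i < length k - (q + 1) \<and> 0 < bspline k q i x"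
proof -
  let ?P = "\<lambda>j. x < k ! (j + q)"
  \<comment> \<open>Shifted by \<open>q\<close>, this is the first end knot, of value 1. The
    subtraction does not truncate, since \<open>k\<close> has at least \<open>2 * q + 2\<close>
    entries.\<close>
  have P: "?P (length k - (q + 1) - q)"
    using open_knots_ends[OF assms(1), of q \<alpha>] assms(3) by (simp add: k_def)
  define j where "j = (LEAST j. ?P j)"
  have "?P j" unfolding j_def using P by (rule LeastI)
  have "j \<le> length k - (q + 1) - q" unfolding j_def using P by (rule Least_le)
  have "j \<noteq> 0" using \<open>?P j\<close> open_knots_ends(1)[OF assms(1), of q \<alpha>] assms(2)
    by (intro notI) (simp add: k_def)
  then obtain i where i: "j = Suc i" using not0_implies_Suc by blast
  then have "\<not> ?P i" unfolding j_def by (metis not_less_Least lessI)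
  then have "0 < bspline k q i x"
    using \<open>?P j\<close> \<open>j \<le> _\<close> i sorted_open_knots[OF assms(1)]
    by (intro bspline_pos) (auto simp: k_def)
  moreover have "i < length k - (q + 1)" using \<open>j \<le> _\<close> i by simp
  ultimately show ?thesis by blast
qed

section \<open>Tensor products and the linear structure of NURBS spaces\<close>

lemma finite_tp_index: "finite (tp_index q \<zeta> \<alpha>)"
proof -
  have "tp_index q \<zeta> \<alpha> = PiE UNIV (\<lambda>d. {..<length (open_knots (q d) (\<zeta> d) (\<alpha> d)) - (q d + 1)})"
    by (auto simp: tp_index_def PiE_def Pi_def)
  then show ?thesis by (simp add: finite_PiE)
qed

lemma unit_cube_iff: "\<xi> \<in> unit_cube \<longleftrightarrow> (\<forall>d. 0 < \<xi> $ d \<and> \<xi> $ d < 1)"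
  by (simp add: mem_box_cart)

lemma tp_bspline_nonneg:
  assumes "\<And>d. unit_mesh (\<zeta> d)" "A \<in> tp_index q \<zeta> \<alpha>"
  shows "0 \<le> tp_bspline q \<zeta> \<alpha> A \<xi>"
  unfolding tp_bspline_def
proof (rule prod_nonneg)
  fix d
  have "A d < length (open_knots (q d) (\<zeta> d) (\<alpha> d)) - (q d + 1)"
    using assms(2) by (simp add: tp_index_def)
  then show "0 \<le> bspline (open_knots (q d) (\<zeta> d) (\<alpha> d)) (q d) (A d) (\<xi> $ d)"
    by (intro bspline_nonneg sorted_open_knots assms) linarith
qed

text \<open>No summand is negative, and choosing in each direction a B-spline positive at that
  coordinate makes one summand positive. So NURBS never divide by zero on the cube.\<close>

lemma nurbs_weight_pos:
  assumes "\<And>d. unit_mesh (\<zeta> d)" "\<And>A. A \<in> tp_index q \<zeta> \<alpha> \<Longrightarrow> 0 < w A" "\<xi> \<in> unit_cube"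
  shows "0 < (\<Sum>B\<in>tp_index q \<zeta> \<alpha>. w B * tp_bspline q \<zeta> \<alpha> B \<xi>)"
proof -
  have "\<forall>d. \<exists>i. i < length (open_knots (q d) (\<zeta> d) (\<alpha> d)) - (q d + 1) \<and>
      0 < bspline (open_knots (q d) (\<zeta> d) (\<alpha> d)) (q d) i (\<xi> $ d)"
    using assms(3) by (intro allI exists_bspline_pos assms) (auto simp: unit_cube_iff)
  then obtain A where A: "\<And>d. A d < length (open_knots (q d) (\<zeta> d) (\<alpha> d)) - (q d + 1)"
     "\<And>d. 0 < bspline (open_knots (q d) (\<zeta> d) (\<alpha> d)) (q d) (A d) (\<xi> $ d)" by metis
  have mem: "A \<in> tp_index q \<zeta> \<alpha>" using A(1) by (simp add: tp_index_def)
  show ?thesis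
  proof (rule sum_pos2[OF finite_tp_index mem])
    show "0 < w A * tp_bspline q \<zeta> \<alpha> A \<xi>"
      unfolding tp_bspline_def using A(2) assms(2)[OF mem] by (intro mult_pos_pos prod_pos) auto
    show "0 \<le> w B * tp_bspline q \<zeta> \<alpha> B \<xi>" if "B \<in> tp_index q \<zeta> \<alpha>" for B
      using that by (intro mult_nonneg_nonneg tp_bspline_nonneg less_imp_le[OF assms(2)] assms(1))
  qed
qed

text \<open>With all coefficients equal to \<open>c\<close>, the numerators add up to
  \<open>c\<close> times the common denominator: the rational basis is a partition of unity by
  construction.\<close>

lemma nurbs_space_const:
  assumes "\<And>d. unit_mesh (\<zeta> d)" "\<And>A. A \<in> tp_index q \<zeta> \<alpha> \<Longrightarrow> 0 < w A"
  shows "(\<lambda>_. c) \<in> nurbs_space q \<zeta> \<alpha> w"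
proof -
  have "c = (\<Sum>A\<in>tp_index q \<zeta> \<alpha>. c * nurbs_basis q \<zeta> \<alpha> w A \<xi>)" if "\<xi> \<in> unit_cube" for \<xi>
  proof -
    have "0 < (\<Sum>B\<in>tp_index q \<zeta> \<alpha>. w B * tp_bspline q \<zeta> \<alpha> B \<xi>)"
      by (rule nurbs_weight_pos) (use assms that in auto)
    then show ?thesis
      by (simp add: nurbs_basis_def sum_distrib_left[symmetric] sum_divide_distrib[symmetric])
  qed
  then show ?thesis unfolding nurbs_space_def mem_Collect_eq by (intro exI[of _ "\<lambda>_. c"]) blast
qed

lemma nurbs_space_add:
  assumes "f \<in> nurbs_space q \<zeta> \<alpha> w" "g \<in> nurbs_space q \<zeta> \<alpha> w"
  shows "(\<lambda>\<xi>. f \<xi> + g \<xi>) \<in> nurbs_space q \<zeta> \<alpha> w"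
proof -
  obtain c d where
    "\<forall>\<xi>\<in>unit_cube. f \<xi> = (\<Sum>A\<in>tp_index q \<zeta> \<alpha>. c A * nurbs_basis q \<zeta> \<alpha> w A \<xi>)"
    "\<forall>\<xi>\<in>unit_cube. g \<xi> = (\<Sum>A\<in>tp_index q \<zeta> \<alpha>. d A * nurbs_basis q \<zeta> \<alpha> w A \<xi>)"
    using assms by (auto simp: nurbs_space_def)
  then show ?thesis unfolding nurbs_space_def mem_Collect_eq
    by (intro exI[of _ "\<lambda>A. c A + d A"]) (simp add: sum.distrib distrib_right)
qed

lemma nurbs_space_cmul:
  assumes "f \<in> nurbs_space q \<zeta> \<alpha> w"
  shows "(\<lambda>\<xi>. s * f \<xi>) \<in> nurbs_space q \<zeta> \<alpha> w"
proof -
  obtain c where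
    "\<forall>\<xi>\<in>unit_cube. f \<xi> = (\<Sum>A\<in>tp_index q \<zeta> \<alpha>. c A * nurbs_basis q \<zeta> \<alpha> w A \<xi>)"
    using assms by (auto simp: nurbs_space_def)
  then show ?thesis unfolding nurbs_space_def mem_Collect_eq
    by (intro exI[of _ "\<lambda>A. s * c A"]) (simp add: sum_distrib_left mult.assoc)
qed

text \<open>All three components range over the same scalar space, so a matrix may mix them. This is
  what admits rotations as test functions.\<close>

lemma nurbs_space3_matrix:
  assumes "f \<in> nurbs_space3 q \<zeta> \<alpha> w"
  shows "(\<lambda>\<xi>. (K :: real^3^3) *v f \<xi>) \<in> nurbs_space3 q \<zeta> \<alpha> w"
  using assms unfolding nurbs_space3_def mem_Collect_eq matrix_vector_mult_def sum_3 vec_lambda_beta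
  by (intro allI nurbs_space_add nurbs_space_cmul) auto

lemma nurbs_space3_add:
  assumes "f \<in> nurbs_space3 q \<zeta> \<alpha> w" "g \<in> nurbs_space3 q \<zeta> \<alpha> w"
  shows "(\<lambda>\<xi>. f \<xi> + g \<xi>) \<in> nurbs_space3 q \<zeta> \<alpha> w"
  using assms by (simp add: nurbs_space3_def nurbs_space_add)

lemma nurbs_space3_scaleR:
  assumes "f \<in> nurbs_space3 q \<zeta> \<alpha> w"
  shows "(\<lambda>\<xi>. s *\<^sub>R f \<xi>) \<in> nurbs_space3 q \<zeta> \<alpha> w"
  using assms by (simp add: nurbs_space3_def nurbs_space_cmul)

section \<open>Mesh elements and differentiability of discrete fields\<close>

lemma unit_mesh_no_knot_between:
  assumes "unit_mesh \<zeta>" "t \<in> set \<zeta>" "Suc i < length \<zeta>"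
  shows "t \<le> \<zeta> ! i \<or> \<zeta> ! Suc i \<le> t"
proof -
  obtain j where j: "j < length \<zeta>" "t = \<zeta> ! j" using assms(2) by (auto simp: in_set_conv_nth)
  consider "j < i" | "j = i" | "j = Suc i" | "Suc i < j" by linarith
  then show ?thesis
    using unit_mesh_nth(3)[OF assms(1), of j i] unit_mesh_nth(3)[OF assms(1), of "Suc i" j] j assms(3)
    by cases auto
qed

lemma unit_mesh_cell_exists:
  assumes "unit_mesh \<zeta>" "0 < x" "x < 1"
  shows "\<exists>i. Suc i < length \<zeta> \<and> \<zeta> ! i \<le> x \<and> x < \<zeta> ! Suc i"
proof -
  let ?P = "\<lambda>j. x < \<zeta> ! j"
  have P: "?P (length \<zeta> - 1)" using unit_mesh_nth(2)[OF assms(1)] assms(3) by simp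
  define j where "j = (LEAST j. ?P j)"
  have "?P j" unfolding j_def using P by (rule LeastI)
  have "j \<le> length \<zeta> - 1" unfolding j_def using P by (rule Least_le)
  have "j \<noteq> 0" using \<open>?P j\<close> unit_mesh_nth(1)[OF assms(1)] assms(2) by (intro notI) simp
  then obtain i where i: "j = Suc i" using not0_implies_Suc by blast
  then have "\<not> ?P i" unfolding j_def by (metis not_less_Least lessI)
  moreover have "2 \<le> length \<zeta>" using assms(1) by (simp add: unit_mesh_def)
  ultimately show ?thesis using \<open>?P j\<close> \<open>j \<le> _\<close> i by (intro exI[of _ i]) auto
qed

text \<open>Half-open like the degree-zero B-splines: the cells cover the whole open cube, interior
  element faces included, and splines are smooth on each cell up to its lower faces.\<close>

definition mesh_cell :: "(3 \<Rightarrow> real list) \<Rightarrow> (3 \<Rightarrow> nat) \<Rightarrow> (real^3) set" where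
  "mesh_cell \<zeta> I = {\<xi>. \<forall>d. \<zeta> d ! I d \<le> \<xi> $ d \<and> \<xi> $ d < \<zeta> d ! Suc (I d)}"

definition mesh_planes :: "(3 \<Rightarrow> real list) \<Rightarrow> (real^3) set" where
  "mesh_planes \<zeta> = {\<xi>. \<exists>d. \<xi> $ d \<in> set (\<zeta> d)}"

lemma mesh_cell_exists:
  assumes "\<And>d. unit_mesh (\<zeta> d)" "\<xi> \<in> unit_cube"
  shows "\<exists>I. (\<forall>d. Suc (I d) < length (\<zeta> d)) \<and> \<xi> \<in> mesh_cell \<zeta> I"
proof -
  have "\<forall>d. \<exists>i. Suc i < length (\<zeta> d) \<and> \<zeta> d ! i \<le> \<xi> $ d \<and> \<xi> $ d < \<zeta> d ! Suc i"
    using assms by (intro allI unit_mesh_cell_exists) (auto simp: unit_cube_iff)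
  then show ?thesis unfolding mesh_cell_def mem_Collect_eq by metis
qed

lemma tp_bspline_differentiable_on:
  assumes "\<And>d. unit_mesh (\<zeta> d)" "A \<in> tp_index q \<zeta> \<alpha>" "\<And>d. Suc (I d) < length (\<zeta> d)"
  shows "tp_bspline q \<zeta> \<alpha> A differentiable_on mesh_cell \<zeta> I"
proof -
  have *: "(\<lambda>\<xi>. bspline (open_knots (q d) (\<zeta> d) (\<alpha> d)) (q d) (A d) (\<xi> $ d)) differentiable_on mesh_cell \<zeta> I"
    (is "(\<lambda>\<xi>. ?b (\<xi> $ d)) differentiable_on _") for d
  proof (rule differentiable_on_compose[where f = ?b])
    show "(\<lambda>\<xi>. \<xi> $ d) differentiable_on mesh_cell \<zeta> I"
      by (rule bounded_linear_imp_differentiable_on) (rule bounded_linear_vec_nth)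
    have "A d < length (open_knots (q d) (\<zeta> d) (\<alpha> d)) - (q d + 1)"
      using assms(2) by (simp add: tp_index_def)
    then have "?b differentiable_on {\<zeta> d ! I d..<\<zeta> d ! Suc (I d)}"
      using unit_mesh_no_knot_between[OF assms(1) _ assms(3)] set_open_knots[OF assms(1)]
      by (intro bspline_differentiable_on) (linarith, blast)
    then show "?b differentiable_on (\<lambda>\<xi>. \<xi> $ d) ` mesh_cell \<zeta> I"
      by (rule differentiable_on_subset) (auto simp: mesh_cell_def)
  qed
  have "(\<lambda>\<xi>. \<Prod>d\<in>UNIV. bspline (open_knots (q d) (\<zeta> d) (\<alpha> d)) (q d) (A d) (\<xi> $ d)) differentiable_on mesh_cell \<zeta> I"
    unfolding UNIV_3 by (simp add: *)
  then show ?thesis unfolding tp_bspline_def[abs_def] .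
qed

text \<open>On a cell every tensor-product spline is differentiable, and the denominator is positive
  on the cube, so the quotient rule applies.\<close>

lemma nurbs_differentiable_on:
  assumes "\<And>d. unit_mesh (\<zeta> d)" "\<And>A. A \<in> tp_index q \<zeta> \<alpha> \<Longrightarrow> 0 < w A"
    and "\<And>d. Suc (I d) < length (\<zeta> d)" "f \<in> nurbs_space q \<zeta> \<alpha> w"
  shows "f differentiable_on (unit_cube \<inter> mesh_cell \<zeta> I)"
  unfolding differentiable_on_def
proof
  let ?S = "unit_cube \<inter> mesh_cell \<zeta> I"
  fix \<xi> assume \<xi>: "\<xi> \<in> ?S"
  obtain c where c:
    "\<And>\<xi>. \<xi> \<in> unit_cube \<Longrightarrow> f \<xi> = (\<Sum>A\<in>tp_index q \<zeta> \<alpha>. c A * nurbs_basis q \<zeta> \<alpha> w A \<xi>)"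
    using assms(4) by (auto simp: nurbs_space_def)
  have tp: "tp_bspline q \<zeta> \<alpha> A differentiable (at \<xi> within ?S)" if "A \<in> tp_index q \<zeta> \<alpha>" for A
  proof -
    have "tp_bspline q \<zeta> \<alpha> A differentiable_on ?S"
      by (rule differentiable_on_subset[OF tp_bspline_differentiable_on[OF assms(1) that assms(3)]]) simp
    then show ?thesis using \<xi> unfolding differentiable_on_def by blast
  qed
  have "0 < (\<Sum>B\<in>tp_index q \<zeta> \<alpha>. w B * tp_bspline q \<zeta> \<alpha> B \<xi>)"
    by (rule nurbs_weight_pos) (use assms(1,2) \<xi> in auto)
  then have "(\<Sum>B\<in>tp_index q \<zeta> \<alpha>. w B * tp_bspline q \<zeta> \<alpha> B \<xi>) \<noteq> 0" by simp
  then have "(\<lambda>\<xi>. \<Sum>A\<in>tp_index q \<zeta> \<alpha>. c A * nurbs_basis q \<zeta> \<alpha> w A \<xi>) differentiable (at \<xi> within ?S)"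
    unfolding nurbs_basis_def
    by (intro differentiable_sum differentiable_mult differentiable_divide differentiable_const
        finite_tp_index tp ballI)
  then show "f differentiable (at \<xi> within ?S)"
    by (rule differentiable_transform_within[OF _ zero_less_one \<xi>]) (simp add: c)
qed

lemma nurbs3_differentiable_on:
  assumes "\<And>d. unit_mesh (\<zeta> d)" "\<And>A. A \<in> tp_index q \<zeta> \<alpha> \<Longrightarrow> 0 < w A"
    and "\<And>d. Suc (I d) < length (\<zeta> d)" "f \<in> nurbs_space3 q \<zeta> \<alpha> w"
  shows "f differentiable_on (unit_cube \<inter> mesh_cell \<zeta> I)"
proof -
  have "(\<lambda>\<xi>. f \<xi> $ i) differentiable_on (unit_cube \<inter> mesh_cell \<zeta> I)" for i
    by (rule nurbs_differentiable_on[of \<zeta> q \<alpha> w]) (use assms in \<open>auto simp: nurbs_space3_def\<close>)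
  then show ?thesis
    unfolding differentiable_on_def
    by (subst differentiable_componentwise_within) (auto simp: Basis_vec_def inner_axis)
qed

text \<open>Off the mesh planes a point lies in the open interior \<open>?T\<close> of its cell,
  where differentiability relative to the cell becomes differentiability proper.\<close>

lemma nurbs3_differentiable_at:
  assumes "\<And>d. unit_mesh (\<zeta> d)" "\<And>A. A \<in> tp_index q \<zeta> \<alpha> \<Longrightarrow> 0 < w A"
    and "f \<in> nurbs_space3 q \<zeta> \<alpha> w" "\<xi> \<in> unit_cube - mesh_planes \<zeta>"
  shows "f differentiable (at \<xi>)"
proof -
  obtain I where I: "\<And>d. Suc (I d) < length (\<zeta> d)" "\<xi> \<in> mesh_cell \<zeta> I"
    using mesh_cell_exists[of \<zeta> \<xi>] assms(1) assms(4) by blast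
  let ?T = "unit_cube \<inter> box (\<chi> d. \<zeta> d ! I d) (\<chi> d. \<zeta> d ! Suc (I d))"
  have "?T \<subseteq> unit_cube \<inter> mesh_cell \<zeta> I" by (auto simp: mesh_cell_def mem_box_cart less_imp_le)
  then have "f differentiable_on ?T"
    by (rule differentiable_on_subset[rotated]) (intro nurbs3_differentiable_on[of \<zeta> q \<alpha> w] assms I)
  moreover have "\<zeta> d ! I d \<noteq> \<xi> $ d" for d
    using assms(4) nth_mem[OF Suc_lessD[OF I(1)[of d]]] unfolding mesh_planes_def by fastforce
  then have "\<xi> \<in> ?T" using I(2) assms(4)
    by (auto simp: mesh_cell_def mem_box_cart less_le)
  moreover have "open ?T" by (intro open_Int open_box)
  ultimately show ?thesis using differentiable_on_eq_differentiable_at by blast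
qed

lemma negligible_mesh_planes: "negligible (mesh_planes \<zeta>)"
proof -
  have "mesh_planes \<zeta> = (\<Union>d. \<Union>t\<in>set (\<zeta> d). {\<xi>. \<xi> $ d = t})" by (auto simp: mesh_planes_def)
  moreover
  have "negligible (\<Union>t\<in>set (\<zeta> d). {\<xi>. \<xi> $ d = t})" for d
    by (intro negligible_Union) (auto simp: cart_eq_inner_axis negligible_standard_hyperplane)
  then have "negligible (\<Union>d. \<Union>t\<in>set (\<zeta> d). {\<xi>. \<xi> $ d = t})"
    by (intro negligible_Union) auto
  ultimately show ?thesis by simp
qed

text \<open>A continuous injection may map a plane onto a set of positive measure. Here \<open>\<psi>\<close> is, on each
  half-open cell including its lower faces, the restriction of a differentiable function.\<close>

lemma negligible_image_mesh_planes:
  assumes "\<And>d. unit_mesh (\<zeta> d)" "\<And>A. A \<in> tp_index q \<zeta> \<alpha> \<Longrightarrow> 0 < w A"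
    and "\<psi> \<in> nurbs_space3 q \<zeta> \<alpha> w"
  shows "negligible (\<psi> ` (unit_cube \<inter> mesh_planes \<zeta>))"
proof -
  let ?J = "{I. \<forall>d. Suc (I d) < length (\<zeta> d)}"
  let ?N = "\<lambda>I. unit_cube \<inter> mesh_cell \<zeta> I \<inter> mesh_planes \<zeta>"
  have "negligible (\<psi> ` ?N I)" if "I \<in> ?J" for I
  proof (rule negligible_differentiable_image_negligible)
    show "negligible (?N I)" using negligible_mesh_planes negligible_subset by blast
    show "\<psi> differentiable_on ?N I"
    proof (rule differentiable_on_subset)
      show "\<psi> differentiable_on (unit_cube \<inter> mesh_cell \<zeta> I)"
        using that by (intro nurbs3_differentiable_on[of \<zeta> q \<alpha> w] assms) auto
    qed auto
  qed simp
  then have "negligible (\<Union>I\<in>?J. \<psi> ` ?N I)"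
    by (intro negligible_countable_Union) auto
  moreover have "\<psi> ` (unit_cube \<inter> mesh_planes \<zeta>) \<subseteq> (\<Union>I\<in>?J. \<psi> ` ?N I)"
    using mesh_cell_exists[of \<zeta>] assms(1) by blast
  ultimately show ?thesis by (rule negligible_subset)
qed

text \<open>On \<Omega> the field is \<open>(W \<circ> \<psi>) \<circ> \<psi>'\<close>. Away from
  the image of the mesh planes, a null set, the chain rule applies to both factors.\<close>

lemma push_space_AE_differentiable:
  assumes "\<And>d. unit_mesh (\<zeta> d)" "\<And>A. A \<in> tp_index q \<zeta> \<alpha> \<Longrightarrow> 0 < w A"
    and "geometrical_map \<zeta> \<Omega> \<psi>" "\<psi> \<in> nurbs_space3 q \<zeta> \<alpha> w" "open \<Omega>"
    and "W \<in> push_space \<psi> (nurbs_space3 q \<zeta> \<alpha> w)"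
  shows "AE X in lebesgue_on \<Omega>. W differentiable (at X)"
proof -
  obtain \<psi>' where hom: "homeomorphism unit_cube \<Omega> \<psi> \<psi>'"
    using assms(3) by (auto simp: geometrical_map_def)
  let ?N = "\<psi> ` (unit_cube \<inter> mesh_planes \<zeta>)"
  have diff: "W differentiable (at X)" if X: "X \<in> \<Omega>" "X \<notin> ?N" for X
  proof -
    define \<xi> where "\<xi> = \<psi>' X"
    have \<xi>: "\<xi> \<in> unit_cube" "\<psi> \<xi> = X"
      using hom X(1) by (auto simp: \<xi>_def homeomorphism_def)
    then have plane: "\<xi> \<in> unit_cube - mesh_planes \<zeta>" using X(2) by blast
    then have "\<psi> differentiable (at \<xi>)" and det: "det (jacobian \<psi> (at \<xi>)) \<noteq> 0"
      using assms(3) by (auto simp: geometrical_map_def mesh_planes_def)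
    then have der: "(\<psi> has_derivative (\<lambda>h. jacobian \<psi> (at \<xi>) *v h)) (at \<xi>)"
      using jacobian_works by blast
    obtain D where D: "jacobian \<psi> (at \<xi>) ** D = mat 1"
      using det by (auto simp: invertible_det_nz[symmetric] invertible_def)
    \<comment> \<open>Inverse function theorem for a continuous injection of the open cube that has
      an invertible Jacobian at the single point \<xi>.\<close>
    have "(\<psi>' has_derivative (*v) D) (at (\<psi> \<xi>))"
    proof (rule has_derivative_inverse_strong[OF open_box \<xi>(1) _ _ der])
      show "continuous_on unit_cube \<psi>" "\<And>x. x \<in> unit_cube \<Longrightarrow> \<psi>' (\<psi> x) = x"
        using hom by (auto simp: homeomorphism_def)
      show "(*v) (jacobian \<psi> (at \<xi>)) \<circ> (*v) D = id"
        by (auto simp: matrix_vector_mul_assoc D)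
    qed
    then have "\<psi>' differentiable (at X)" using \<xi>(2) by (auto simp: differentiable_def)
    moreover have "(W \<circ> \<psi>) differentiable (at (\<psi>' X))"
      using assms(6) plane unfolding \<xi>_def[symmetric] push_space_def mem_Collect_eq
      by (intro nurbs3_differentiable_at[of \<zeta> q \<alpha> w] assms)
    ultimately have "((W \<circ> \<psi>) \<circ> \<psi>') differentiable (at X)"
      by (rule differentiable_chain_at)
    \<comment> \<open>The composition agrees with \<open>W\<close> only on \<Omega>, so the
      replacement is made within \<Omega>; openness then restores the full derivative.\<close>
    then have "((W \<circ> \<psi>) \<circ> \<psi>') differentiable (at X within \<Omega>)"
      by (rule differentiable_at_withinI)
    then have "W differentiable (at X within \<Omega>)"
      by (rule differentiable_transform_within[OF _ zero_less_one X(1)])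
        (use hom in \<open>auto simp: homeomorphism_def\<close>)
    then show ?thesis using at_within_open[OF X(1) assms(5)] by simp
  qed
  have "negligible ?N" by (intro negligible_image_mesh_planes[of \<zeta> q \<alpha> w]) (use assms in auto)
  then have "AE X in lebesgue. X \<notin> ?N" by (intro AE_not_in) (simp add: negligible_iff_null_sets)
  then show ?thesis
    using assms(5) diff by (subst AE_restrict_space_iff) (auto elim!: eventually_mono)
qed

section \<open>Skew matrices and gradients of rigid motions\<close>

lemma matrix_mult_uminus:
  fixes A :: "real^'k^'m" and B :: "real^'n^'k"
  shows "(- A) ** B = - (A ** B)" "A ** (- B) = - (A ** B)"
  by (simp_all add: vec_eq_iff matrix_matrix_mult_def sum_negf)

lemma transpose_inner_transpose: "transpose A \<bullet> transpose B = A \<bullet> (B :: real^'n^'m)"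
  unfolding inner_vec_def transpose_def by (simp, subst sum.swap, rule refl)

lemma matrix_mult_inner: "(A ** B) \<bullet> C = A \<bullet> (C ** transpose (B :: real^'n^'k))"
  for A :: "real^'k^'m" and C :: "real^'n^'m"
proof -
  have "(\<Sum>j\<in>UNIV. (\<Sum>k\<in>UNIV. A $ i $ k * B $ k $ j) * C $ i $ j)
      = (\<Sum>k\<in>UNIV. A $ i $ k * (\<Sum>j\<in>UNIV. C $ i $ j * B $ k $ j))" for i
    unfolding sum_distrib_right sum_distrib_left by (subst sum.swap) (simp add: mult_ac)
  then show ?thesis by (simp add: inner_vec_def matrix_matrix_mult_def transpose_def)
qed

text \<open>Transposing both factors preserves the inner product but here flips its sign.\<close>

lemma skew_inner_symmetric:
  fixes K S :: "real^'n^'n"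
  assumes "transpose K = - K" "transpose S = S"
  shows "K \<bullet> S = 0"
  using transpose_inner_transpose[of K S] assms by simp

lemma skew_congruence_inner_symmetric:
  fixes F K S :: "real^'n^'n"
  assumes "transpose K = - K" "transpose S = S"
  shows "(transpose F ** (K ** F)) \<bullet> S = 0"
proof (rule skew_inner_symmetric[OF _ assms(2)])
  have "transpose (transpose F ** (K ** F)) = transpose F ** (- K) ** F"
    by (simp add: matrix_transpose_mul assms(1))
  also have "\<dots> = - (transpose F ** (K ** F))"
    by (simp add: matrix_mult_uminus matrix_mul_assoc)
  finally show "transpose (transpose F ** (K ** F)) = - (transpose F ** (K ** F))" .
qed

text \<open>Moving \<open>F\<close> to the other side of the inner product leaves \<open>K\<close>
  against the identity, which is symmetric.\<close>

lemma skew_mult_inner_inv_transp: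
  fixes F K :: "real^3^3"
  assumes "transpose K = - K" "det F \<noteq> 0"
  shows "(K ** F) \<bullet> inv_transp F = 0"
proof -
  \<comment> \<open>\<open>matrix_inv\<close> is a choice of a two-sided inverse, so existence must
    come first.\<close>
  have "\<exists>G. F ** G = mat 1 \<and> G ** F = mat 1"
    using assms(2) by (simp add: invertible_det_nz[symmetric] invertible_def)
  then have "F ** matrix_inv F = mat 1"
    unfolding matrix_inv_def by (rule someI2_ex) blast
  then have "inv_transp F ** transpose F = mat 1"
    by (metis inv_transp_def matrix_transpose_mul transpose_mat)
  then show ?thesis
    by (simp add: matrix_mult_inner skew_inner_symmetric[OF assms(1)])
qed

lemma cross3_matrix: "matrix (cross3 c) *v x = cross3 c x"
  by (simp add: matrix_def matrix_vector_mult_def vec_eq_iff forall_3 cross3_def axis_def sum_3)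

lemma transpose_matrix_cross3: "transpose (matrix (cross3 c)) = - matrix (cross3 c)"
  by (simp add: matrix_def transpose_def vec_eq_iff forall_3 cross3_def axis_def)

lemma cross3_triple_scalar: "cross3 c x \<bullet> y = c \<bullet> cross3 x y"
  by (simp add: cross3_simps)

text \<open>The hypothesis is the mid-point rule \<open>(u1 - u0) / dt = (v0 + v1) / 2\<close>; it makes the discrete
  product rule for \<open>\<phi> \<times> V\<close> lose the term in which the increment of \<open>\<phi>\<close> appears.\<close>

lemma cross3_increment_midpoint:
  fixes x u0 u1 v0 v1 :: "real^3"
  assumes "(u1 - u0) /\<^sub>R dt = midpoint v0 v1" "dt \<noteq> 0"
  shows "cross3 (x + u1) v1 - cross3 (x + u0) v0 = cross3 (x + midpoint u0 u1) (v1 - v0)"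
proof -
  have u1: "u1 = u0 + dt *\<^sub>R midpoint v0 v1"
    using assms by (simp add: assms(1)[symmetric])
  show ?thesis unfolding u1 midpoint_def
    by (simp add: cross3_simps forall_3 field_simps)
qed

section \<open>Gradients of rigid motions, boundary traces, and testing with vectors\<close>

lemma jacobian_eqI:
  fixes f :: "real^'n \<Rightarrow> real^'m"
  shows "(f has_derivative (\<lambda>h. A *v h)) (at X) \<Longrightarrow> jacobian f (at X) = A"
  unfolding jacobian_def by (simp add: frechet_derivative_at[symmetric])

lemma grad_const: "grad (\<lambda>_. c) X = 0"
  by (rule jacobian_eqI) (simp add: matrix_vector_mult_def vec_eq_iff zero_vec_def[symmetric])

text \<open>Chain rule for a linear map after the deformation; with \<open>U_m\<close> for
  \<open>U\<close> the right-hand side is \<open>K ** F_m X\<close>.\<close>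

lemma grad_matrix_deformation:
  assumes "U differentiable (at X)"
  shows "grad (\<lambda>X. K *v (X + U X)) X = K ** (grad U X + mat 1)"
proof (rule jacobian_eqI)
  have "(U has_derivative (\<lambda>h. grad U X *v h)) (at X)" using assms jacobian_works by blast
  then have "((\<lambda>X. X + U X) has_derivative (\<lambda>h. h + grad U X *v h)) (at X)"
    by (intro has_derivative_add has_derivative_ident)
  then have "((\<lambda>X. K *v (X + U X)) has_derivative (\<lambda>h. K *v (h + grad U X *v h))) (at X)"
    by (rule bounded_linear.has_derivative[OF matrix_vector_mul_bounded_linear])
  moreover have "K *v (h + grad U X *v h) = (K ** (grad U X + mat 1)) *v h" for h
    by (simp add: matrix_vector_mul_assoc[symmetric] matrix_vector_mult_add_rdistrib add.commute)
  ultimately show "((\<lambda>X. K *v (X + U X)) has_derivative (\<lambda>h. (K ** (grad U X + mat 1)) *v h)) (at X)"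
    by simp
qed

text \<open>A frontier point of an open set lies in the closure but not in the set, hence is a limit
  point. Traces are therefore genuine, unique limits.\<close>

lemma open_frontier_nontrivial_limit:
  assumes "open \<Omega>" "X \<in> frontier \<Omega>"
  shows "at X within \<Omega> \<noteq> bot"
proof -
  have "X \<in> closure \<Omega>" "X \<notin> \<Omega>"
    using assms frontier_disjoint_eq[of \<Omega>] by (auto simp: frontier_def)
  then have "X islimpt \<Omega>" by (auto simp: closure_def)
  then show ?thesis by (simp add: trivial_limit_within)
qed

lemma trace_on_eqI: "at X within \<Omega> \<noteq> bot \<Longrightarrow> (W \<longlongrightarrow> l) (at X within \<Omega>) \<Longrightarrow> trace_on \<Omega> W X = l"
  unfolding trace_on_def by (rule tendsto_Lim)

lemma inner_eqI: "(\<And>c. c \<bullet> x = c \<bullet> y) \<Longrightarrow> x = (y :: 'a :: real_inner)"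
  by (metis inner_commute vector_eq_rdot)

section \<open>Momentum balance\<close>

theorem proposition2:
  fixes \<Omega> \<Gamma>G \<Gamma>H :: "(real^3) set"
    and \<rho>0 :: "real^3 \<Rightarrow> real"
    and \<gamma> :: real
    and B H G :: "real^3 \<Rightarrow> real \<Rightarrow> real^3"
    and \<zeta> :: "3 \<Rightarrow> real list"
    and r :: "3 \<Rightarrow> nat \<Rightarrow> int"
    and p a b :: nat
    and wS wP :: "(3 \<Rightarrow> nat) \<Rightarrow> real"
    and \<psi> :: "real^3 \<Rightarrow> real^3"
    and Shat Sh VV :: "(real^3 \<Rightarrow> real^3) set"
    and Phat Ph VP :: "(real^3 \<Rightarrow> real) set"
    and t_n t_n1 t_m \<Delta>t :: real
    and U_n U_n1 U_m V_n V_n1 V_m B_m H_m \<phi>_n \<phi>_n1 \<phi>_m :: "real^3 \<Rightarrow> real^3"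
    and P_n P_n1 P_m J_m :: "real^3 \<Rightarrow> real"
    and F_m Salg :: "real^3 \<Rightarrow> real^3^3"
  \<comment> \<open>domain and data\<close>
  assumes "open \<Omega>" and "bounded \<Omega>" and "lipschitz_boundary \<Omega>"
    and "frontier \<Omega> = \<Gamma>G \<union> \<Gamma>H" and "\<Gamma>G \<inter> \<Gamma>H = {}"
    and "\<And>X. X \<in> \<Omega> \<Longrightarrow> 0 < \<rho>0 X" and "0 \<le> \<gamma>"
  \<comment> \<open>discrete spaces\<close>
    and "\<And>d. unit_mesh (\<zeta> d)"
    and "\<And>d i. 1 \<le> i \<Longrightarrow> i < length (\<zeta> d) - 1 \<Longrightarrow> - 1 \<le> r d i \<and> r d i \<le> int p - 1"
    and "1 \<le> a" and "b < a"
    and "\<And>A. A \<in> tp_index (\<lambda>d. p + a) \<zeta> (\<lambda>d i. r d i + int b) \<Longrightarrow> 0 < wS A"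
    and "\<And>A. A \<in> tp_index (\<lambda>d. p) \<zeta> r \<Longrightarrow> 0 < wP A"
    and "Shat = nurbs_space3 (\<lambda>d. p + a) \<zeta> (\<lambda>d i. r d i + int b) wS"
    and "Phat = nurbs_space (\<lambda>d. p) \<zeta> r wP"
    and "\<And>f. f \<in> Shat \<Longrightarrow> continuous_on unit_cube f"
    and "geometrical_map \<zeta> \<Omega> \<psi>" and "\<psi> \<in> Shat"
    and "Sh = push_space \<psi> Shat" and "Ph = push_space \<psi> Phat"
    and "VV = with_bc Sh \<Omega> \<Gamma>G (\<lambda>X. 0)" and "VP = Ph"
  \<comment> \<open>states and mid-point quantities\<close>
    and "t_n < t_n1" and "\<Delta>t = t_n1 - t_n"
    and "U_n \<in> with_bc Sh \<Omega> \<Gamma>G (\<lambda>X. G X t_n)" and "U_n1 \<in> with_bc Sh \<Omega> \<Gamma>G (\<lambda>X. G X t_n1)"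
    and "P_n \<in> Ph" and "P_n1 \<in> Ph"
    and "V_n \<in> with_bc Sh \<Omega> \<Gamma>G (\<lambda>X. vector_derivative (G X) (at t_n))"
    and "V_n1 \<in> with_bc Sh \<Omega> \<Gamma>G (\<lambda>X. vector_derivative (G X) (at t_n1))"
    and "t_m = midpoint t_n t_n1"
    and "U_m = (\<lambda>X. midpoint (U_n X) (U_n1 X))"
    and "P_m = (\<lambda>X. midpoint (P_n X) (P_n1 X))"
    and "V_m = (\<lambda>X. midpoint (V_n X) (V_n1 X))"
    and "F_m = (\<lambda>X. grad U_m X + mat 1)"
    and "J_m = (\<lambda>X. det (F_m X))" and "AE X in lebesgue_on \<Omega>. 0 < J_m X"
    and "B_m = (\<lambda>X. B X t_m)" and "H_m = (\<lambda>X. H X t_m)"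
    and "\<phi>_n = (\<lambda>X. X + U_n X)" and "\<phi>_n1 = (\<lambda>X. X + U_n1 X)" and "\<phi>_m = (\<lambda>X. X + U_m X)"
  \<comment> \<open>regularity: boundary values exist and all integrals are finite\<close>
    and "\<And>W. W \<in> Sh \<Longrightarrow> AE X in surface_on \<Gamma>H. \<exists>l. (W \<longlongrightarrow> l) (at X within \<Omega>)"
    and "\<And>Q. Q \<in> VP \<Longrightarrow> integrable (lebesgue_on \<Omega>)
           (\<lambda>X. Q X * J_m X * (grad V_m X \<bullet> inv_transp (F_m X)))"
    and "\<And>W. W \<in> VV \<Longrightarrow> integrable (lebesgue_on \<Omega>)
           (\<lambda>X. W X \<bullet> (\<rho>0 X *\<^sub>R ((V_n1 X - V_n X) /\<^sub>R \<Delta>t))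
              + (transpose (F_m X) ** grad W X) \<bullet> Salg X
              - J_m X * P_m X * (grad W X \<bullet> inv_transp (F_m X))
              - W X \<bullet> (\<rho>0 X *\<^sub>R B_m X))"
    and "\<And>W. W \<in> VV \<Longrightarrow> integrable (surface_on \<Gamma>H) (\<lambda>X. trace_on \<Omega> W X \<bullet> H_m X)"
    and "\<And>W. W \<in> VV \<Longrightarrow> integrable (lebesgue_on \<Omega>)
           (\<lambda>X. \<gamma> * J_m X * (grad W X \<bullet> inv_transp (F_m X)) * (grad V_m X \<bullet> inv_transp (F_m X)))"
    and "integrable (lebesgue_on \<Omega>) (\<lambda>X. \<rho>0 X *\<^sub>R V_n X)"
    and "integrable (lebesgue_on \<Omega>) (\<lambda>X. \<rho>0 X *\<^sub>R V_n1 X)"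
    and "integrable (lebesgue_on \<Omega>) (\<lambda>X. \<rho>0 X *\<^sub>R cross3 (\<phi>_n X) (V_n X))"
    and "integrable (lebesgue_on \<Omega>) (\<lambda>X. \<rho>0 X *\<^sub>R cross3 (\<phi>_n1 X) (V_n1 X))"
    and "integrable (lebesgue_on \<Omega>) (\<lambda>X. \<rho>0 X *\<^sub>R B_m X)"
    and "integrable (lebesgue_on \<Omega>) (\<lambda>X. \<rho>0 X *\<^sub>R cross3 (\<phi>_m X) (B_m X))"
    and "integrable (surface_on \<Gamma>H) H_m"
    and "integrable (surface_on \<Gamma>H) (\<lambda>X. cross3 (trace_on \<Omega> \<phi>_m X) (H_m X))"
  \<comment> \<open>the discrete equations (i)-(iii)\<close>
    and "\<And>X. X \<in> \<Omega> \<Longrightarrow> 0 = (U_n1 X - U_n X) /\<^sub>R \<Delta>t - V_m X"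
    and "\<And>Q. Q \<in> VP \<Longrightarrow>
           0 = (LINT X|lebesgue_on \<Omega>. Q X * J_m X * (grad V_m X \<bullet> inv_transp (F_m X)))"
    and "\<And>W. W \<in> VV \<Longrightarrow>
           0 = (LINT X|lebesgue_on \<Omega>.
                  W X \<bullet> (\<rho>0 X *\<^sub>R ((V_n1 X - V_n X) /\<^sub>R \<Delta>t))
                  + (transpose (F_m X) ** grad W X) \<bullet> Salg X
                  - J_m X * P_m X * (grad W X \<bullet> inv_transp (F_m X))
                  - W X \<bullet> (\<rho>0 X *\<^sub>R B_m X))
             - (LINT X|surface_on \<Gamma>H. trace_on \<Omega> W X \<bullet> H_m X)
             + (LINT X|lebesgue_on \<Omega>.
                  \<gamma> * J_m X * (grad W X \<bullet> inv_transp (F_m X)) * (grad V_m X \<bullet> inv_transp (F_m X)))"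
    and "\<Gamma>G = {}"
  shows "(linear_momentum \<Omega> \<rho>0 V_n1 - linear_momentum \<Omega> \<rho>0 V_n) /\<^sub>R \<Delta>t
           = (LINT X|lebesgue_on \<Omega>. \<rho>0 X *\<^sub>R B_m X) + (LINT X|surface_on \<Gamma>H. H_m X)
       \<and> ((AE X in lebesgue_on \<Omega>. transpose (Salg X) = Salg X) \<longrightarrow>
         (angular_momentum \<Omega> \<rho>0 \<phi>_n1 V_n1 - angular_momentum \<Omega> \<rho>0 \<phi>_n V_n) /\<^sub>R \<Delta>t
           = (LINT X|lebesgue_on \<Omega>. \<rho>0 X *\<^sub>R cross3 (\<phi>_m X) (B_m X))
             + (LINT X|surface_on \<Gamma>H. cross3 (trace_on \<Omega> \<phi>_m X) (H_m X)))"
proof -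
  note mesh = assms(8) and wS = assms(12) and geom = assms(17) and \<psi> = assms(18)
    and Shat = assms(14) and Sh = assms(19) and F_m = assms(35) and J_m = assms(36)
  let ?q = "\<lambda>d::3. p + a" and ?\<alpha> = "\<lambda>d i. r d i + int b"
  \<comment> \<open>Over an empty Dirichlet part \<open>with_bc\<close> imposes no constraint, so
    every discrete field is a test function.\<close>
  have VV: "VV = Sh" using assms(21) \<open>\<Gamma>G = {}\<close> by (simp add: with_bc_def)
  have \<Gamma>H: "frontier \<Omega> = \<Gamma>H" using assms(4) \<open>\<Gamma>G = {}\<close> by simp
  have dt: "0 < \<Delta>t" using assms(23,24) by simp
  have lim: "at X within \<Omega> \<noteq> bot" if "X \<in> \<Gamma>H" for X
    using open_frontier_nontrivial_limit[OF assms(1)] that \<Gamma>H by blast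
  have space_\<Gamma>H: "space (surface_on \<Gamma>H) = \<Gamma>H"
    by (simp add: space_restrict_space surface_measure_def space_measure_of_conv)
  have add: "(\<lambda>X. f X + g X) \<in> Sh" if "f \<in> Sh" "g \<in> Sh" for f g
    using that nurbs_space3_add[of "f \<circ> \<psi>" _ _ _ _ "g \<circ> \<psi>"]
    by (simp add: Sh Shat push_space_def comp_def)
  have scale: "(\<lambda>X. s *\<^sub>R f X) \<in> Sh" if "f \<in> Sh" for s f
    using that nurbs_space3_scaleR[of "f \<circ> \<psi>"] by (simp add: Sh Shat push_space_def comp_def)
  have matrix: "(\<lambda>X. K *v f X) \<in> Sh" if "f \<in> Sh" for f and K :: "real^3^3"
    using that nurbs_space3_matrix[of "f \<circ> \<psi>"] by (simp add: Sh Shat push_space_def comp_def)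
  have const: "(\<lambda>X. c) \<in> Sh" for c
    using nurbs_space_const[of \<zeta> ?q ?\<alpha> wS, OF mesh wS]
    by (simp add: Sh Shat push_space_def nurbs_space3_def comp_def)
  \<comment> \<open>The pull-back of the identity is \<psi> itself, which is where isoparametric
    interpolation enters.\<close>
  have ident: "(\<lambda>X. X) \<in> Sh" using \<psi> by (simp add: Sh push_space_def comp_def)
  have U_m: "U_m \<in> Sh"
    unfolding assms(32) midpoint_def
    using assms(25,26) by (intro scale add) (auto simp: with_bc_def)
  have \<phi>_m: "\<phi>_m \<in> Sh" unfolding assms(42) by (intro add ident U_m)

  \<comment> \<open>Common core of both balances: equation (iii) for a \<open>W\<close> that does no
    work against stress and pressure. \<open>A\<close>, \<open>E\<close>, \<open>T\<close> are the
    vector densities of inertia, body force and traction obtained once \<open>c\<close> is factored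
    out.\<close>
  have momentum: "c \<bullet> (LINT X|lebesgue_on \<Omega>. A X)
      = c \<bullet> (LINT X|lebesgue_on \<Omega>. E X) + c \<bullet> (LINT X|surface_on \<Gamma>H. T X)"
    if W: "W \<in> VV"
      and rigid: "AE X in lebesgue_on \<Omega>. (transpose (F_m X) ** grad W X) \<bullet> Salg X = 0"
        "AE X in lebesgue_on \<Omega>. grad W X \<bullet> inv_transp (F_m X) = 0"
      and A: "integrable (lebesgue_on \<Omega>) A"
        "\<And>X. X \<in> \<Omega> \<Longrightarrow> W X \<bullet> (\<rho>0 X *\<^sub>R ((V_n1 X - V_n X) /\<^sub>R \<Delta>t)) = c \<bullet> A X"
      and E: "integrable (lebesgue_on \<Omega>) E" "\<And>X. X \<in> \<Omega> \<Longrightarrow> W X \<bullet> (\<rho>0 X *\<^sub>R B_m X) = c \<bullet> E X"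
      and T: "integrable (surface_on \<Gamma>H) T"
        "AE X in surface_on \<Gamma>H. trace_on \<Omega> W X \<bullet> H_m X = c \<bullet> T X"
    for W A E T c
  proof -
    have bulk: "(LINT X|lebesgue_on \<Omega>.
                  W X \<bullet> (\<rho>0 X *\<^sub>R ((V_n1 X - V_n X) /\<^sub>R \<Delta>t))
                  + (transpose (F_m X) ** grad W X) \<bullet> Salg X
                  - J_m X * P_m X * (grad W X \<bullet> inv_transp (F_m X))
                  - W X \<bullet> (\<rho>0 X *\<^sub>R B_m X)) = (LINT X|lebesgue_on \<Omega>. c \<bullet> A X - c \<bullet> E X)"
    \<comment> \<open>Measurability of the two integrands is obtained from their
      integrability.\<close>
    proof (rule integral_cong_AE[OF borel_measurable_integrable borel_measurable_integrable])
      show "AE X in lebesgue_on \<Omega>. W X \<bullet> (\<rho>0 X *\<^sub>R ((V_n1 X - V_n X) /\<^sub>R \<Delta>t))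
                  + (transpose (F_m X) ** grad W X) \<bullet> Salg X
                  - J_m X * P_m X * (grad W X \<bullet> inv_transp (F_m X))
                  - W X \<bullet> (\<rho>0 X *\<^sub>R B_m X) = c \<bullet> A X - c \<bullet> E X"
        using rigid AE_space
      proof eventually_elim
        case (elim X)
        then have "X \<in> \<Omega>" by simp
        show ?case unfolding A(2)[OF \<open>X \<in> \<Omega>\<close>] E(2)[OF \<open>X \<in> \<Omega>\<close>] elim by simp
      qed
    qed (use assms(45)[OF W] A(1) E(1) in auto)
    have traction: "(LINT X|surface_on \<Gamma>H. trace_on \<Omega> W X \<bullet> H_m X) = (LINT X|surface_on \<Gamma>H. c \<bullet> T X)"
      using assms(46)[OF W] T
      by (intro integral_cong_AE borel_measurable_integrable) auto
    have graddiv: "(LINT X|lebesgue_on \<Omega>.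
        \<gamma> * J_m X * (grad W X \<bullet> inv_transp (F_m X)) * (grad V_m X \<bullet> inv_transp (F_m X))) = 0"
      by (rule integral_eq_zero_AE) (use rigid(2) in eventually_elim, simp)
    show ?thesis
      using assms(58)[OF W] A(1) E(1) T(1) unfolding bulk traction graddiv by simp
  qed

  \<comment> \<open>Linear momentum: translations as test functions\<close>
  have linear: "(linear_momentum \<Omega> \<rho>0 V_n1 - linear_momentum \<Omega> \<rho>0 V_n) /\<^sub>R \<Delta>t
           = (LINT X|lebesgue_on \<Omega>. \<rho>0 X *\<^sub>R B_m X) + (LINT X|surface_on \<Gamma>H. H_m X)"
  proof (rule inner_eqI)
    fix c :: "real^3"
    have tr: "trace_on \<Omega> (\<lambda>X. c) X = c" if "X \<in> \<Gamma>H" for X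
      by (rule trace_on_eqI[OF lim[OF that] tendsto_const])
    have "c \<bullet> (LINT X|lebesgue_on \<Omega>. (\<rho>0 X *\<^sub>R V_n1 X - \<rho>0 X *\<^sub>R V_n X) /\<^sub>R \<Delta>t)
        = c \<bullet> (LINT X|lebesgue_on \<Omega>. \<rho>0 X *\<^sub>R B_m X) + c \<bullet> (LINT X|surface_on \<Gamma>H. H_m X)"
    proof (rule momentum[of "\<lambda>X. c"])
      show "integrable (lebesgue_on \<Omega>) (\<lambda>X. (\<rho>0 X *\<^sub>R V_n1 X - \<rho>0 X *\<^sub>R V_n X) /\<^sub>R \<Delta>t)"
        using assms(48,49) by simp
    qed (use assms(52,54) tr in \<open>auto simp: VV const grad_const space_\<Gamma>H algebra_simps
          matrix_matrix_mult_def zero_vec_def[symmetric] intro!: AE_I2\<close>)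
    then show "c \<bullet> ((linear_momentum \<Omega> \<rho>0 V_n1 - linear_momentum \<Omega> \<rho>0 V_n) /\<^sub>R \<Delta>t)
        = c \<bullet> ((LINT X|lebesgue_on \<Omega>. \<rho>0 X *\<^sub>R B_m X) + (LINT X|surface_on \<Gamma>H. H_m X))"
      using assms(48,49) by (simp add: linear_momentum_def inner_add_right)
  qed

  \<comment> \<open>Angular momentum: infinitesimal rotations as test functions\<close>
  have angular: "(angular_momentum \<Omega> \<rho>0 \<phi>_n1 V_n1 - angular_momentum \<Omega> \<rho>0 \<phi>_n V_n) /\<^sub>R \<Delta>t
           = (LINT X|lebesgue_on \<Omega>. \<rho>0 X *\<^sub>R cross3 (\<phi>_m X) (B_m X))
             + (LINT X|surface_on \<Gamma>H. cross3 (trace_on \<Omega> \<phi>_m X) (H_m X))"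
    if sym: "AE X in lebesgue_on \<Omega>. transpose (Salg X) = Salg X"
  proof (rule inner_eqI)
    fix c :: "real^3"
    let ?K = "matrix (cross3 c)"
    \<comment> \<open>This is \<open>c \<times> \<phi>_m\<close>, in matrix form so that the closure
      and gradient lemmas apply.\<close>
    let ?W = "\<lambda>X. ?K *v \<phi>_m X"
    have "AE X in lebesgue_on \<Omega>. U_m differentiable (at X)"
      using U_m by (intro push_space_AE_differentiable[of \<zeta> ?q ?\<alpha> wS _ \<psi>] mesh wS geom assms(1))
        (use \<psi> in \<open>auto simp: Sh Shat\<close>)
    then have grad: "AE X in lebesgue_on \<Omega>. grad ?W X = ?K ** F_m X"
      by eventually_elim (simp only: grad_matrix_deformation F_m assms(42))
    have stress: "AE X in lebesgue_on \<Omega>. (transpose (F_m X) ** grad ?W X) \<bullet> Salg X = 0"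
      using grad sym
      by eventually_elim (simp add: skew_congruence_inner_symmetric transpose_matrix_cross3)
    \<comment> \<open>Positivity of \<open>J_m\<close> almost everywhere makes \<open>F_m\<close>
      invertible there.\<close>
    have pressure: "AE X in lebesgue_on \<Omega>. grad ?W X \<bullet> inv_transp (F_m X) = 0"
      using grad assms(37)
      by eventually_elim (simp add: skew_mult_inner_inv_transp transpose_matrix_cross3 J_m)
    \<comment> \<open>The scalar triple product frees \<open>c\<close>, and the mid-point rule (i)
      turns the remaining cross product into the increment of the angular momentum density.\<close>
    have inertia: "?W X \<bullet> (\<rho>0 X *\<^sub>R ((V_n1 X - V_n X) /\<^sub>R \<Delta>t))
        = c \<bullet> ((\<rho>0 X *\<^sub>R cross3 (\<phi>_n1 X) (V_n1 X) - \<rho>0 X *\<^sub>R cross3 (\<phi>_n X) (V_n X)) /\<^sub>R \<Delta>t)"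
      if "X \<in> \<Omega>" for X
    proof -
      have "cross3 (\<phi>_n1 X) (V_n1 X) - cross3 (\<phi>_n X) (V_n X) = cross3 (\<phi>_m X) (V_n1 X - V_n X)"
        unfolding assms(40,41,42,32)
        using assms(56)[OF that] dt by (intro cross3_increment_midpoint[where dt = \<Delta>t]) (auto simp: assms(34))
      then show ?thesis
        by (simp add: cross3_matrix cross3_triple_scalar cross_mult_right
            flip: scaleR_diff_right)
    qed
    have "AE X in surface_on \<Gamma>H. \<exists>l. (\<phi>_m \<longlongrightarrow> l) (at X within \<Omega>)"
      by (rule assms(43)[OF \<phi>_m])
    then have tr: "AE X in surface_on \<Gamma>H.
        trace_on \<Omega> ?W X \<bullet> H_m X = c \<bullet> cross3 (trace_on \<Omega> \<phi>_m X) (H_m X)"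
      using AE_space
    proof eventually_elim
      case (elim X)
      then obtain l where l: "(\<phi>_m \<longlongrightarrow> l) (at X within \<Omega>)" and X: "X \<in> \<Gamma>H"
        by (auto simp: space_\<Gamma>H)
      \<comment> \<open>A linear map commutes with limits, so the trace of \<open>?W\<close> is
        \<open>?K\<close> applied to the trace of \<open>\<phi>_m\<close>.\<close>
      have "(?W \<longlongrightarrow> ?K *v l) (at X within \<Omega>)"
        by (rule bounded_linear.tendsto[OF matrix_vector_mul_bounded_linear l])
      from trace_on_eqI[OF lim[OF X] this] trace_on_eqI[OF lim[OF X] l] show ?case
        by (simp only: cross3_matrix cross3_triple_scalar)
    qed
    have "c \<bullet> (LINT X|lebesgue_on \<Omega>.
            (\<rho>0 X *\<^sub>R cross3 (\<phi>_n1 X) (V_n1 X) - \<rho>0 X *\<^sub>R cross3 (\<phi>_n X) (V_n X)) /\<^sub>R \<Delta>t)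
        = c \<bullet> (LINT X|lebesgue_on \<Omega>. \<rho>0 X *\<^sub>R cross3 (\<phi>_m X) (B_m X))
          + c \<bullet> (LINT X|surface_on \<Gamma>H. cross3 (trace_on \<Omega> \<phi>_m X) (H_m X))"
    proof (rule momentum[OF _ stress pressure _ inertia _ _ _ tr])
      show "?W \<in> VV" unfolding VV by (rule matrix[OF \<phi>_m])
    qed (use assms(50,51,53,55) in \<open>auto simp: cross3_matrix cross3_triple_scalar\<close>)
    then show "c \<bullet> ((angular_momentum \<Omega> \<rho>0 \<phi>_n1 V_n1 - angular_momentum \<Omega> \<rho>0 \<phi>_n V_n) /\<^sub>R \<Delta>t)
        = c \<bullet> ((LINT X|lebesgue_on \<Omega>. \<rho>0 X *\<^sub>R cross3 (\<phi>_m X) (B_m X))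
          + (LINT X|surface_on \<Gamma>H. cross3 (trace_on \<Omega> \<phi>_m X) (H_m X)))"
      using assms(50,51) by (simp add: angular_momentum_def inner_add_right)
  qed
  show ?thesis using linear angular by blast
qed

end
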